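(* Let $A\in\mathbb{R}^{d\times d}$ be a matrix, let $N$ be a positive integer, let $u^{(1)},\dots,u^{(N)}$ be independent random vectors with $u^{(j)}\sim\mathcal{N}(0,I_d)$, and let $g\in\mathbb{R}^d$ be the random vector $$g=\frac{1}{2N}\sum_{j=1}^{N}\big[u^{(j)}\big]^\top A\,u^{(j)}\cdot\Big([u^{(j)}]^2-\mathbf{1}_d\Big).$$ Let $1\le p\le d$ be an integer, $0<\delta<1$ and $\varepsilon>0$. If $$N\ge\frac{V}{4\delta\varepsilon^2},\qquad V=2\big(\mathrm{tr}(A)+4A_{p,p}\big)^2+\|A+A^\top\|^2+8\|A_{p,:}^\top+A_{:,p}\|^2-12A_{p,p}^2,$$ then with probability at least $1-\delta$, $$A_{p,p}-\varepsilon\le g_p\le A_{p,p}+\varepsilon.$$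
   Context: $A$ is an arbitrary deterministic real $d\times d$ matrix (not assumed symmetric or positive semidefinite). $A_{i,j}$ is the $(i,j)$ entry; $A_{p,:}$ is the $p$-th row (a row vector) and $A_{:,p}$ the $p$-th column. For a matrix $M$, $\|M\|=\sqrt{\mathrm{tr}(M^\top M)}$ is the Frobenius norm; for a vector, $\|\cdot\|$ is the Euclidean norm. For a vector $u$, $[u]^2$ is the entrywise square, and $\mathbf{1}_d$ is the all-ones vector in $\mathbb{R}^d$. $g_p$ is the $p$-th coordinate of $g$. The vector $g$ is the output of the stochastic diagonal estimation algorithm that accesses $A$ only through the quadratic forms $u^\top A u$ at $N$ independent standard Gaussian vectors. *)

theory Defs
  imports "HOL-Probability.Probability"
begin

definition frobenius_norm :: "real ^ 'n ^ 'm \<Rightarrow> real" where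
  "frobenius_norm M = sqrt (trace (transpose M ** M))"

(* Lebesgue density of N(0, I_d), d = CARD('d) *)
definition std_gaussian_density :: "real ^ 'd \<Rightarrow> real" where
  "std_gaussian_density x = exp (- (norm x)\<^sup>2 / 2) / sqrt ((2 * pi) ^ CARD('d))"

definition std_gaussian_vector :: "'a measure \<Rightarrow> ('a \<Rightarrow> real ^ 'd) \<Rightarrow> bool" where
  "std_gaussian_vector M X \<longleftrightarrow> distributed M lborel X (\<lambda>x. ennreal (std_gaussian_density x))"

definition vec_square :: "real ^ 'd \<Rightarrow> real ^ 'd" where
  "vec_square u = (\<chi> i. (u $ i)\<^sup>2)"

definition diag_estimate :: "real ^ 'd ^ 'd \<Rightarrow> nat \<Rightarrow> (nat \<Rightarrow> real ^ 'd) \<Rightarrow> real ^ 'd" where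
  "diag_estimate A N u =
     (1 / (2 * real N)) *\<^sub>R
       (\<Sum>j = 1..N. (u j \<bullet> (A *v u j)) *\<^sub>R (vec_square (u j) - vec 1))"

definition diag_variance :: "real ^ 'd ^ 'd \<Rightarrow> 'd \<Rightarrow> real" where
  "diag_variance A p =
     2 * (trace A + 4 * A $ p $ p)\<^sup>2 + (frobenius_norm (A + transpose A))\<^sup>2
       + 8 * (norm (row p A + column p A))\<^sup>2 - 12 * (A $ p $ p)\<^sup>2"

end

theory Submission
  imports Defs
begin

text \<open>Each summand \<open>(u\<^sup>T A u) (u\<^sub>p\<^sup>2 - 1)\<close> has mean \<open>2 A\<^sub>p\<^sub>p\<close> and variance exactly \<open>V\<close>, so \<open>g\<^sub>p\<close> has
  mean \<open>A\<^sub>p\<^sub>p\<close> and variance \<open>V / (4 N)\<close>, and Chebyshev's inequality gives the bound. The moments of a summand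
  are sums of Gaussian moments of coordinate monomials, which Stein's identity reduces to Kronecker deltas.\<close>

section \<open>Moments of coordinate monomials\<close>

text \<open>The recursion comes from integration by parts; in this form it makes
  \<open>coord_moment_Cons\<close> immediate.\<close>

fun std_normal_moment :: "nat \<Rightarrow> real" where
  "std_normal_moment 0 = 1"
| "std_normal_moment (Suc 0) = 0"
| "std_normal_moment (Suc (Suc n)) = real (Suc n) * std_normal_moment n"

lemma std_normal_moment_even_eq: "std_normal_moment (2 * k) = fact (2 * k) / (2 ^ k * fact k)"
proof (induction k)
  case (Suc k)
  have "std_normal_moment (2 * Suc k) = real (2 * k + 1) * (fact (2 * k) / (2 ^ k * fact k))"
    using Suc by simp
  also have "\<dots> = fact (2 * Suc k) / (2 ^ Suc k * fact (Suc k))"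
    by (simp add: divide_simps)
  finally show ?case .
qed simp

lemma std_normal_moment_odd_eq: "std_normal_moment (2 * k + 1) = 0"
  by (induction k) auto

lemma has_bochner_integral_std_normal_moment:
  "has_bochner_integral lborel (\<lambda>x. std_normal_density x * x ^ n) (std_normal_moment n)"
proof (cases "even n")
  case True
  then obtain k where "n = 2 * k" by blast
  then show ?thesis using std_normal_moment_even[of k] std_normal_moment_even_eq[of k] by simp
next
  case False
  then obtain k where "n = 2 * k + 1" using oddE by blast
  then show ?thesis using std_normal_moment_odd[of k] std_normal_moment_odd_eq[of k] by simp
qed

lemma borel_measurable_vec_nth [measurable]:
  "(\<lambda>x :: real ^ 'd. x $ i) \<in> borel_measurable borel"
  by (intro borel_measurable_continuous_onI continuous_intros)

text \<open>Fubini for a product integrand. \<open>lborel\<close> on vectors is the image of a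
  product measure indexed by basis vectors, so coordinates are reindexed along
  \<open>axis i 1\<close>.\<close>

lemma has_bochner_integral_lborel_prod_vec:
  fixes f :: "'d::finite \<Rightarrow> real \<Rightarrow> real"
  assumes f: "\<And>i. has_bochner_integral lborel (f i) (c i)"
  shows "has_bochner_integral lborel (\<lambda>x::real^'d. \<Prod>i\<in>UNIV. f i (x $ i)) (\<Prod>i\<in>UNIV. c i)"
proof -
  interpret P: product_sigma_finite "\<lambda>_::real^'d. lborel :: real measure"
    by standard
  define h where "h = inv (\<lambda>i::'d. axis i (1::real))"
  have h: "h (axis i 1) = i" for i
    unfolding h_def by (rule inv_f_f) (auto simp: inj_def axis_eq_axis)
  have bij: "bij_betw (\<lambda>i::'d. axis i (1::real)) UNIV Basis"
    by (auto simp: bij_betw_def inj_on_def axis_eq_axis Basis_vec_def)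
  have int: "integrable lborel (f i)" and eq: "integral\<^sup>L lborel (f i) = c i" for i
    using f[of i] by (auto simp: has_bochner_integral_iff)
  have [measurable]: "f i \<in> borel_measurable borel" for i
    using borel_measurable_integrable[OF int[of i]] by simp
  have coord: "(\<Sum>b\<in>Basis. z b * b $ i) = z (axis i 1)" for z :: "real^'d \<Rightarrow> real" and i
  proof -
    have "(\<Sum>b\<in>Basis. z b *\<^sub>R b) \<bullet> axis i 1 = z (axis i 1)"
      by (simp add: inner_sum_left_Basis)
    then show ?thesis by (simp add: inner_axis del: inner_sum_left_Basis)
  qed
  have re: "(\<Prod>i\<in>UNIV. q i (z (axis i 1))) = (\<Prod>b\<in>Basis. q (h b) (z b))"
    for q :: "'d \<Rightarrow> real \<Rightarrow> real" and z :: "real^'d \<Rightarrow> real"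
    by (simp add: prod.reindex_bij_betw[OF bij, symmetric] h)
  have re': "(\<Prod>i\<in>UNIV. c i) = (\<Prod>b\<in>(Basis :: (real^'d) set). c (h b))"
    by (simp add: prod.reindex_bij_betw[OF bij, symmetric] h)
  have "integrable (\<Pi>\<^sub>M b\<in>(Basis :: (real^'d) set). lborel) (\<lambda>z. \<Prod>b\<in>Basis. f (h b) (z b))"
    by (intro P.product_integrable_prod finite_Basis int)
  moreover have "integral\<^sup>L (\<Pi>\<^sub>M b\<in>(Basis :: (real^'d) set). lborel) (\<lambda>z. \<Prod>b\<in>Basis. f (h b) (z b))
      = (\<Prod>b\<in>(Basis :: (real^'d) set). c (h b))"
    by (subst P.product_integral_prod) (auto intro!: int simp: eq)
  ultimately show ?thesis
    unfolding has_bochner_integral_iff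
    by (subst (1 2) lborel_eq) (simp add: integrable_distr_eq integral_distr coord re re')
qed

lemma norm_vec_power2: "(norm (x :: real ^ 'd))\<^sup>2 = (\<Sum>i\<in>UNIV. (x $ i)\<^sup>2)"
  unfolding power2_norm_eq_inner inner_vec_def by (simp add: power2_eq_square)

lemma std_gaussian_density_eq_prod:
  "std_gaussian_density x = (\<Prod>i\<in>UNIV. std_normal_density (x $ i))"
proof -
  have "exp (- (norm x)\<^sup>2 / 2) = (\<Prod>i\<in>UNIV. exp (- (x $ i)\<^sup>2 / 2))"
    by (simp add: norm_vec_power2 exp_sum[symmetric] sum_negf sum_divide_distrib)
  then show ?thesis
    by (simp add: std_gaussian_density_def std_normal_density_def prod_dividef real_sqrt_power
        real_sqrt_mult power_mult_distrib)
qed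

text \<open>The standard Gaussian expectation of the monomial whose factors are the coordinates
  listed in \<open>L\<close>. A list with repetitions keeps the indices symbolic until a case split
  decides which coincide.\<close>

definition coord_moment :: "'d::finite list \<Rightarrow> real" where
  "coord_moment L = (\<Prod>i\<in>UNIV. std_normal_moment (count_list L i))"

lemma prod_list_eq_prod_count:
  fixes x :: "'d::finite \<Rightarrow> real"
  shows "(\<Prod>i\<leftarrow>L. x i) = (\<Prod>i\<in>UNIV. x i ^ count_list L i)"
proof (induction L)
  case (Cons a L)
  have "(\<Prod>i\<in>UNIV. x i ^ count_list (a # L) i)
      = (\<Prod>i\<in>UNIV. (if i = a then x i else 1) * x i ^ count_list L i)"
    by (intro prod.cong) auto
  then show ?case using Cons by (simp add: prod.distrib)
qed simp

text \<open>Density and monomial both factor over the coordinates, so the integral is a product of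
  one-dimensional moments.\<close>

lemma std_gaussian_vector_coord_moment:
  fixes X :: "'a \<Rightarrow> real ^ 'd"
  assumes "std_gaussian_vector M X"
  shows "has_bochner_integral M (\<lambda>\<omega>. \<Prod>i\<leftarrow>L. X \<omega> $ i) (coord_moment L)"
proof -
  have D: "distributed M lborel X (\<lambda>x. ennreal (std_gaussian_density x))"
    using assms by (simp add: std_gaussian_vector_def)
  have m: "(\<lambda>x::real^'d. \<Prod>i\<leftarrow>L. x $ i) \<in> borel_measurable lborel"
    unfolding prod_list_eq_prod_count by measurable
  have nn: "0 \<le> std_gaussian_density x" for x :: "real^'d"
    by (simp add: std_gaussian_density_def)
  have "has_bochner_integral lborel
      (\<lambda>x::real^'d. std_gaussian_density x * (\<Prod>i\<leftarrow>L. x $ i)) (coord_moment L)"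
    using has_bochner_integral_lborel_prod_vec[of "\<lambda>i t. std_normal_density t * t ^ count_list L i",
        OF has_bochner_integral_std_normal_moment]
    by (simp add: coord_moment_def std_gaussian_density_eq_prod prod_list_eq_prod_count prod.distrib)
  then show ?thesis
    using distributed_integral[OF D m nn] distributed_integrable[OF D m nn]
    by (simp add: has_bochner_integral_iff)
qed

text \<open>Truncated subtraction covers the case where \<open>a\<close> does not occur in
  \<open>L\<close>.\<close>

lemma count_list_remove1:
  "count_list (remove1 a L) i = (if i = a then count_list L i - 1 else count_list L i)"
proof (induction L)
  case (Cons b L)
  have "count_list L a > 0 \<or> a \<notin> set L" by (auto simp: count_list_0_iff)
  then show ?case using Cons by (auto simp: remove1_idem)
qed simp

lemma coord_moment_Nil: "coord_moment [] = 1"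
  by (simp add: coord_moment_def)

text \<open>Stein's identity \<open>E[u\<^sub>a f(u)] = E[\<partial>\<^sub>a f(u)]\<close> for a monomial \<open>f\<close>.\<close>
lemma coord_moment_Cons:
  "coord_moment (a # L) = real (count_list L a) * coord_moment (remove1 a L)"
proof -
  let ?R = "\<Prod>i\<in>UNIV - {a}. std_normal_moment (count_list L i)"
  have "coord_moment (a # L) = std_normal_moment (Suc (count_list L a)) * ?R"
    unfolding coord_moment_def
    by (subst prod.remove[of _ a]) (auto intro!: prod.cong)
  moreover have "coord_moment (remove1 a L) = std_normal_moment (count_list L a - 1) * ?R"
    unfolding coord_moment_def
    by (subst prod.remove[of _ a]) (auto intro!: prod.cong simp: count_list_remove1)
  ultimately show ?thesis
    \<comment> \<open>If \<open>a\<close> does not occur in \<open>L\<close>, both sides vanish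
      because the first moment is 0; otherwise the moment recursion applies.\<close>
    by (cases "count_list L a") auto
qed

text \<open>Being an abbreviation, it reaches the simplifier as a plain \<open>if\<close>, which
  collapses finite sums.\<close>

abbreviation (input) kdelta :: "'d \<Rightarrow> 'd \<Rightarrow> real" where
  "kdelta i j \<equiv> (if i = j then 1 else 0)"

text \<open>The weight \<open>x_p^2 - 1\<close> is the second Hermite polynomial, so two uses of
  Stein's identity give the mean of the second \<open>p\<close>-derivative of
  \<open>x_i x_j\<close>.\<close>

lemma coord_moment_weighted2:
  "coord_moment [i, j, p, p] - coord_moment [i, j] = 2 * kdelta i p * kdelta j p"
  by (cases "i = j"; cases "i = p"; cases "j = p")
     (simp_all add: coord_moment_Cons coord_moment_Nil)

text \<open>The coefficients 2, 8, 24 are the expectations of \<open>(x\<^sup>2 - 1)\<^sup>2\<close> and of its second and fourth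
  derivatives at a standard normal \<open>x\<close>.\<close>
lemma coord_moment_weighted4:
  "coord_moment [i, j, k, l, p, p, p, p] - 2 * coord_moment [i, j, k, l, p, p] + coord_moment [i, j, k, l]
   = 2 * (kdelta i j * kdelta k l + kdelta i k * kdelta j l + kdelta i l * kdelta j k)
   + 8 * (kdelta i j * kdelta k p * kdelta l p + kdelta k l * kdelta i p * kdelta j p
        + kdelta i k * kdelta j p * kdelta l p + kdelta j l * kdelta i p * kdelta k p
        + kdelta i l * kdelta j p * kdelta k p + kdelta j k * kdelta i p * kdelta l p)
   + 24 * (kdelta i p * kdelta j p * kdelta k p * kdelta l p)"
  \<comment> \<open>All ten equalities among the five indices are decided, so every count becomes a
    numeral and Stein's identity evaluates each moment.\<close>
  by (cases "i = j"; cases "i = k"; cases "i = l"; cases "i = p"; cases "j = k"; cases "j = l";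
      cases "j = p"; cases "k = l"; cases "k = p"; cases "l = p";
      simp add: coord_moment_Cons coord_moment_Nil)

section \<open>A single sample\<close>

definition sample :: "real ^ 'd ^ 'd \<Rightarrow> 'd \<Rightarrow> real ^ 'd \<Rightarrow> real" where
  "sample A p x = (x \<bullet> (A *v x)) * ((x $ p)\<^sup>2 - 1)"

text \<open>The monomials are written as list products so that
  \<open>std_gaussian_vector_coord_moment\<close> applies term by term.\<close>

lemma sample_eq_sum:
  "sample A p x = (\<Sum>i\<in>UNIV. \<Sum>j\<in>UNIV. A $ i $ j *
     ((\<Prod>i\<leftarrow>[i, j, p, p]. x $ i) - (\<Prod>i\<leftarrow>[i, j]. x $ i)))"
  by (simp add: sample_def inner_vec_def matrix_vector_mult_def sum_distrib_left sum_distrib_right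
      algebra_simps power2_eq_square)

lemma sample_power2_eq_sum:
  "(sample A p x)\<^sup>2 = (\<Sum>i\<in>UNIV. \<Sum>j\<in>UNIV. \<Sum>k\<in>UNIV. \<Sum>l\<in>UNIV. A $ i $ j * A $ k $ l *
     ((\<Prod>i\<leftarrow>[i, j, k, l, p, p, p, p]. x $ i) - 2 * (\<Prod>i\<leftarrow>[i, j, k, l, p, p]. x $ i)
       + (\<Prod>i\<leftarrow>[i, j, k, l]. x $ i)))"
proof -
  have "(sample A p x)\<^sup>2 = (\<Sum>i\<in>UNIV. \<Sum>j\<in>UNIV. x $ i * (A $ i $ j * x $ j)) *
      (\<Sum>k\<in>UNIV. \<Sum>l\<in>UNIV. x $ k * (A $ k $ l * x $ l)) * ((x $ p)\<^sup>2 - 1)\<^sup>2"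
    by (simp add: sample_def inner_vec_def matrix_vector_mult_def sum_distrib_left
        power_mult_distrib power2_eq_square)
  also have "\<dots> = (\<Sum>i\<in>UNIV. \<Sum>j\<in>UNIV. \<Sum>k\<in>UNIV. \<Sum>l\<in>UNIV.
      (x $ i * (A $ i $ j * x $ j)) * (x $ k * (A $ k $ l * x $ l)) * ((x $ p)\<^sup>2 - 1)\<^sup>2)"
    \<comment> \<open>Distributing in this order keeps the sums over \<open>i\<close>,
      \<open>j\<close> outside those over \<open>k\<close>, \<open>l\<close>.\<close>
    unfolding sum_distrib_right unfolding sum_distrib_left unfolding sum_distrib_right ..
  finally show ?thesis
    by (simp add: algebra_simps power2_eq_square)
qed

lemma borel_measurable_sample [measurable]: "sample A p \<in> borel_measurable borel"
proof -
  have "continuous_on UNIV (\<lambda>x. x \<bullet> (A *v x))"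
    by (intro continuous_on_inner continuous_on_id matrix_vector_mult_linear_continuous_on)
  then show ?thesis
    unfolding sample_def[abs_def]
    by (intro borel_measurable_continuous_onI continuous_intros)
qed

lemma frobenius_norm_power2: "(frobenius_norm M)\<^sup>2 = (\<Sum>i\<in>UNIV. \<Sum>j\<in>UNIV. (M $ i $ j)\<^sup>2)"
proof -
  have "trace (transpose M ** M) = (\<Sum>i\<in>UNIV. \<Sum>j\<in>UNIV. (M $ i $ j)\<^sup>2)"
    by (subst sum.swap) (simp add: trace_def matrix_matrix_mult_def transpose_def power2_eq_square)
  moreover have "0 \<le> (\<Sum>i\<in>UNIV. \<Sum>j\<in>UNIV. (M $ i $ j)\<^sup>2)"
    by (intro sum_nonneg) auto
  ultimately show ?thesis by (simp add: frobenius_norm_def)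
qed

text \<open>With \<open>mult_if_zero\<close>, this moves a delta out of every sum whose index it
  does not involve, until it reaches a sum that it collapses.\<close>

lemma sum_if_const: "(\<Sum>l\<in>S. if P then f l else 0) = (if P then \<Sum>l\<in>S. f l else (0::real))"
  by simp

lemma mult_if_zero:
  "x * (if b then y else 0) = (if b then x * y else (0::real))"
  "(if b then y else 0) * x = (if b then y * x else (0::real))"
  by simp_all

lemma weighted_sum_eq_diag_variance:
  fixes A :: "real ^ 'd ^ 'd"
  shows "(\<Sum>i\<in>UNIV. \<Sum>j\<in>UNIV. \<Sum>k\<in>UNIV. \<Sum>l\<in>UNIV. A $ i $ j * A $ k $ l *
    (2 * (kdelta i j * kdelta k l + kdelta i k * kdelta j l + kdelta i l * kdelta j k)
   + 8 * (kdelta i j * kdelta k p * kdelta l p + kdelta k l * kdelta i p * kdelta j p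
        + kdelta i k * kdelta j p * kdelta l p + kdelta j l * kdelta i p * kdelta k p
        + kdelta i l * kdelta j p * kdelta k p + kdelta j k * kdelta i p * kdelta l p)
   + 24 * (kdelta i p * kdelta j p * kdelta k p * kdelta l p)))
   = diag_variance A p + (2 * A $ p $ p)\<^sup>2" (is "?S = _")
proof -
  let ?a = "A $ p $ p"
  \<comment> \<open>In matrix terms, \<open>F\<close> is the squared Frobenius norm of
    \<open>A\<close>, \<open>G\<close> is tr(A^2), \<open>R\<close> and \<open>C\<close> are the
    squared norms of row and column \<open>p\<close>, and \<open>H\<close> is the
    \<open>(p, p)\<close> entry of A^2.\<close>
  define F where "F = (\<Sum>i\<in>UNIV. \<Sum>j\<in>UNIV. (A $ i $ j)\<^sup>2)"
  define G where "G = (\<Sum>i\<in>UNIV. \<Sum>j\<in>UNIV. A $ i $ j * A $ j $ i)"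
  define R where "R = (\<Sum>i\<in>UNIV. (A $ p $ i)\<^sup>2)"
  define C where "C = (\<Sum>i\<in>UNIV. (A $ i $ p)\<^sup>2)"
  define H where "H = (\<Sum>i\<in>UNIV. A $ p $ i * A $ i $ p)"
  have "?S = 2 * ((trace A)\<^sup>2 + F + G) + 8 * (2 * ?a * trace A + R + C + 2 * H) + 24 * ?a\<^sup>2"
    unfolding F_def G_def R_def C_def H_def
    by (simp add: distrib_left sum.distrib mult_if_zero sum_if_const trace_def power2_eq_square
       sum_product mult.assoc) (simp add: mult_ac sum_distrib_left)
  moreover have "(frobenius_norm (A + transpose A))\<^sup>2 = 2 * F + 2 * G"
  proof -
    have "(\<Sum>i\<in>UNIV. \<Sum>j\<in>UNIV. (A $ j $ i)\<^sup>2) = F"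
      unfolding F_def by (rule sum.swap)
    then show ?thesis
      by (simp add: frobenius_norm_power2 transpose_def power2_sum sum.distrib F_def G_def
          mult.assoc flip: sum_distrib_left)
  qed
  moreover have "(norm (row p A + column p A))\<^sup>2 = R + C + 2 * H"
    by (simp add: norm_vec_power2 row_def column_def power2_sum sum.distrib R_def C_def H_def
        mult.assoc flip: sum_distrib_left)
  \<comment> \<open>The coefficients of \<open>?a\<close> squared agree: 32 from
    \<open>2 * (trace A + 4 * ?a)^2\<close>, minus 12, plus 4 from the squared mean, is 24.\<close>
  ultimately show ?thesis
    unfolding diag_variance_def by (simp add: power2_eq_square algebra_simps)
qed

text \<open>The factor 2 in the mean is why the estimator divides by \<open>2 * N\<close>.\<close>

lemma sample_expectation:
  assumes "std_gaussian_vector M X"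
  shows "has_bochner_integral M (\<lambda>\<omega>. sample A p (X \<omega>)) (2 * A $ p $ p)"
proof -
  have "has_bochner_integral M (\<lambda>\<omega>. sample A p (X \<omega>))
      (\<Sum>i\<in>UNIV. \<Sum>j\<in>UNIV. A $ i $ j * (coord_moment [i, j, p, p] - coord_moment [i, j]))"
    unfolding sample_eq_sum
    by (intro has_bochner_integral_sum has_bochner_integral_mult_right has_bochner_integral_diff
        std_gaussian_vector_coord_moment assms)
  then show ?thesis
    by (simp add: coord_moment_weighted2 mult_if_zero sum_if_const mult.commute)
qed

lemma sample_second_moment:
  assumes "std_gaussian_vector M X"
  shows "has_bochner_integral M (\<lambda>\<omega>. (sample A p (X \<omega>))\<^sup>2) (diag_variance A p + (2 * A $ p $ p)\<^sup>2)"
proof -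
  let ?S = "\<Sum>i\<in>UNIV. \<Sum>j\<in>UNIV. \<Sum>k\<in>UNIV. \<Sum>l\<in>UNIV. A $ i $ j * A $ k $ l *
      (coord_moment [i, j, k, l, p, p, p, p] - 2 * coord_moment [i, j, k, l, p, p]
        + coord_moment [i, j, k, l])"
  have "has_bochner_integral M (\<lambda>\<omega>. (sample A p (X \<omega>))\<^sup>2) ?S"
    unfolding sample_power2_eq_sum
    by (intro has_bochner_integral_sum has_bochner_integral_mult_right has_bochner_integral_diff
        has_bochner_integral_add std_gaussian_vector_coord_moment assms)
  moreover have "?S = diag_variance A p + (2 * A $ p $ p)\<^sup>2"
    unfolding coord_moment_weighted4 by (rule weighted_sum_eq_diag_variance)
  ultimately show ?thesis by simp
qed

section \<open>Independent samples\<close>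

text \<open>Expand the square: independence factors the cross terms, and only diagonal terms
  contribute variances. Chebyshev's inequality also needs the integrability conclusion.\<close>

lemma (in prob_space) variance_sum_indep_vars:
  fixes X :: "'i \<Rightarrow> 'a \<Rightarrow> real"
  assumes "finite I" and indep: "indep_vars (\<lambda>_. borel) X I"
    and int: "\<And>i. i \<in> I \<Longrightarrow> integrable M (X i)"
    and int2: "\<And>i. i \<in> I \<Longrightarrow> integrable M (\<lambda>\<omega>. (X i \<omega>)\<^sup>2)"
  shows "integrable M (\<lambda>\<omega>. (\<Sum>i\<in>I. X i \<omega>)\<^sup>2)"
    and "variance (\<lambda>\<omega>. \<Sum>i\<in>I. X i \<omega>) = (\<Sum>i\<in>I. variance (X i))"
proof -
  \<comment> \<open>One formula for both cases lets the double sum split into the squared mean plus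
    the variances.\<close>
  have pair: "integrable M (\<lambda>\<omega>. X i \<omega> * X j \<omega>) \<and>
      expectation (\<lambda>\<omega>. X i \<omega> * X j \<omega>)
        = expectation (X i) * expectation (X j) + (if i = j then variance (X i) else 0)"
    if ij: "i \<in> I" "j \<in> I" for i j
  proof (cases "i = j")
    case True
    then show ?thesis
      using int2[OF ij(1)] variance_eq[OF int[OF ij(1)] int2[OF ij(1)]]
      by (simp add: power2_eq_square)
  next
    case False
    have "indep_vars (\<lambda>_. borel) X {i, j}"
      using indep_vars_subset[OF indep] ij by simp
    then show ?thesis
      using indep_vars_integrable[of "{i, j}" X] indep_vars_lebesgue_integral[of "{i, j}" X]
        int ij False by auto
  qed
  have sq: "(\<Sum>i\<in>I. X i \<omega>)\<^sup>2 = (\<Sum>i\<in>I. \<Sum>j\<in>I. X i \<omega> * X j \<omega>)" for \<omega>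
    by (simp add: power2_eq_square sum_product)
  show i2: "integrable M (\<lambda>\<omega>. (\<Sum>i\<in>I. X i \<omega>)\<^sup>2)"
    unfolding sq using pair by (intro Bochner_Integration.integrable_sum) auto
  have "expectation (\<lambda>\<omega>. (\<Sum>i\<in>I. X i \<omega>)\<^sup>2) = (\<Sum>i\<in>I. \<Sum>j\<in>I. expectation (\<lambda>\<omega>. X i \<omega> * X j \<omega>))"
    unfolding sq using pair
    by (simp add: Bochner_Integration.integral_sum Bochner_Integration.integrable_sum)
  also have "\<dots> = (\<Sum>i\<in>I. expectation (X i))\<^sup>2 + (\<Sum>i\<in>I. variance (X i))"
    using pair \<open>finite I\<close> by (simp add: sum.distrib power2_eq_square sum_product)
  finally show "variance (\<lambda>\<omega>. \<Sum>i\<in>I. X i \<omega>) = (\<Sum>i\<in>I. variance (X i))"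
    using int i2 by (subst variance_eq) auto
qed

lemma diag_estimate_nth:
  "diag_estimate A N u $ p = (\<Sum>j = 1..N. sample A p (u j)) / (2 * real N)"
  by (simp add: diag_estimate_def sample_def vec_square_def)

theorem theorem1:
  fixes A :: "real ^ 'd ^ 'd"
    and M :: "'a measure"
    and u :: "nat \<Rightarrow> 'a \<Rightarrow> real ^ 'd"
    and g :: "'a \<Rightarrow> real ^ 'd"
    and N :: nat
    and p :: 'd
    and \<delta> \<epsilon> :: real
  assumes "prob_space M"
    and "N > 0"
    and "prob_space.indep_vars M (\<lambda>_. borel) u {1..N}"
    and "\<And>j. j \<in> {1..N} \<Longrightarrow> std_gaussian_vector M (u j)"
    and "\<And>\<omega>. \<omega> \<in> space M \<Longrightarrow> g \<omega> = diag_estimate A N (\<lambda>j. u j \<omega>)"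
    and "0 < \<delta>" and "\<delta> < 1" and "\<epsilon> > 0"
    and "real N \<ge> diag_variance A p / (4 * \<delta> * \<epsilon>\<^sup>2)"
  shows "measure M {\<omega> \<in> space M. A $ p $ p - \<epsilon> \<le> g \<omega> $ p \<and> g \<omega> $ p \<le> A $ p $ p + \<epsilon>} \<ge> 1 - \<delta>"
proof -
  interpret prob_space M by fact
  let ?X = "\<lambda>j \<omega>. sample A p (u j \<omega>)"
  let ?S = "\<lambda>\<omega>. \<Sum>j = 1..N. ?X j \<omega>"
  have indep: "indep_vars (\<lambda>_. borel) ?X {1..N}"
    by (rule indep_vars_compose2[OF assms(3)]) simp
  have int: "integrable M (?X j)" and mean: "expectation (?X j) = 2 * A $ p $ p"
    and int2: "integrable M (\<lambda>\<omega>. (?X j \<omega>)\<^sup>2)" and var: "variance (?X j) = diag_variance A p"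
    if "j \<in> {1..N}" for j
  proof -
    note 1 = sample_expectation[OF assms(4)[OF that], of A p, unfolded has_bochner_integral_iff]
      and 2 = sample_second_moment[OF assms(4)[OF that], of A p, unfolded has_bochner_integral_iff]
    show "integrable M (?X j)" "expectation (?X j) = 2 * A $ p $ p"
        "integrable M (\<lambda>\<omega>. (?X j \<omega>)\<^sup>2)"
      using 1 2 by auto
    show "variance (?X j) = diag_variance A p"
      using 1 2 by (subst variance_eq) auto
  qed
  have intS: "integrable M ?S" using int by (intro Bochner_Integration.integrable_sum)
  have meanS: "expectation ?S = 2 * real N * A $ p $ p"
    using int mean by (simp add: Bochner_Integration.integral_sum)
  note vS = variance_sum_indep_vars[OF _ indep int int2, simplified]
  have varS: "variance ?S = real N * diag_variance A p"
    using vS(2) var by simp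
  have pos: "0 < 2 * real N * \<epsilon>" using assms by simp
  have S [measurable]: "?S \<in> borel_measurable M" by (rule borel_measurable_integrable[OF intS])
  \<comment> \<open>The bad event is stated for the unnormalised sum, so the deviation
    \<open>\<epsilon>\<close> is scaled by \<open>2 * N\<close>.\<close>
  let ?B = "{\<omega>\<in>space M. \<bar>?S \<omega> - expectation ?S\<bar> \<ge> 2 * real N * \<epsilon>}"
  let ?G = "{\<omega> \<in> space M. A $ p $ p - \<epsilon> \<le> g \<omega> $ p \<and> g \<omega> $ p \<le> A $ p $ p + \<epsilon>}"
  have "prob ?B \<le> variance ?S / (2 * real N * \<epsilon>)\<^sup>2"
    by (rule Chebyshev_inequality[OF S _ pos]) (use vS(1) in simp)
  also have "\<dots> = diag_variance A p / (4 * \<epsilon>\<^sup>2) / real N"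
    using assms(2) unfolding varS by (simp add: power2_eq_square)
  also have "\<dots> \<le> \<delta>"
    using assms(2,6,8,9) by (simp add: field_simps)
  finally have B: "prob ?B \<le> \<delta>" .
  have gp: "g \<omega> $ p = ?S \<omega> / (2 * real N)" if "\<omega> \<in> space M" for \<omega>
    using assms(5)[OF that] by (simp add: diag_estimate_nth)
  \<comment> \<open>\<open>g\<close> is specified only on \<open>space M\<close>, so measurability
    of the event is obtained from the sum \<open>?S\<close>.\<close>
  have "?G = {\<omega> \<in> space M. A $ p $ p - \<epsilon> \<le> ?S \<omega> / (2 * real N) \<and> ?S \<omega> / (2 * real N) \<le> A $ p $ p + \<epsilon>}"
    using gp by auto
  also have "\<dots> \<in> events" by measurable
  finally have G: "?G \<in> events" .
  \<comment> \<open>Off the bad event the deviation is strictly below the threshold, hence within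
    the closed interval.\<close>
  have "space M - ?B \<subseteq> ?G"
  proof
    fix \<omega> assume \<omega>: "\<omega> \<in> space M - ?B"
    then have "\<bar>?S \<omega> - 2 * real N * A $ p $ p\<bar> < 2 * real N * \<epsilon>"
      unfolding meanS by auto
    then have "A $ p $ p - \<epsilon> \<le> ?S \<omega> / (2 * real N)" "?S \<omega> / (2 * real N) \<le> A $ p $ p + \<epsilon>"
      using assms(2) by (simp_all add: field_simps abs_less_iff)
    then show "\<omega> \<in> ?G"
      using \<omega> by (simp add: gp)
  qed
  then have "prob (space M - ?B) \<le> prob ?G"
    using G by (intro finite_measure_mono) auto
  moreover have "prob (space M - ?B) = 1 - prob ?B"
    by (intro prob_compl) measurable
  ultimately show ?thesis using B by linarith
qed

end
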